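(* (a) Let $H=H(x)$, $x>0$, be a continuous function. Then there exists a one-parameter family of rotational surfaces with mean curvature $H(x)$, $x$ being the (non-constant) distance from the surface to the axis of revolution. The surfaces in the family are uniquely determined, up to translations along the $z$-axis, by the geometric linear momenta $\mathcal K(x)$ of their generatrix curves given by $$x\,\mathcal K(x)=2\int x\,H(x)\,dx .$$ (b) Let $K_{\mathrm G}=K_{\mathrm G}(x)$, $x>0$, be a continuous function. Then there exists a one-parameter family of rotational surfaces with Gauss curvature $K_{\mathrm G}(x)$, $x$ being the (non-constant) distance from the surface to the axis of revolution. The surfaces in the family are uniquely determined, up to translations along the $z$-axis, by the geometric linear momenta $\mathcal K(x)$ of their generatrix curves given by $$\mathcal K(x)^2=2\int x\,K_{\mathrm G}(x)\,dx .$$ In both cases the parameter of the family is the integration constant of the indefinite integral.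
   Context: Rotational surfaces: let $\alpha(s)=(x(s),z(s))$ be a $C^2$ curve in the $xz$-plane parametrized by arc length, with $x>0$. The rotational surface $S_\alpha\subset\mathbb{R}^3$ is generated by rotating $\alpha$ around the $z$-axis: $X(s,\theta)=(x(s)\cos\theta,x(s)\sin\theta,z(s))$; $x$ is the distance to the axis of revolution. The geometric linear momentum of $\alpha$ (with respect to the $z$-axis) is $\mathcal K(s)=\dot z(s)$. When $x$ is non-constant one works on arcs where $\dot x\neq0$, oriented so that $\dot x=\sqrt{1-\mathcal K^2}>0$, and regards $\mathcal K=\mathcal K(x)$ as a function of $x$, with values in $(-1,1)$. Accordingly, the formulas in the claim are understood on intervals of $x>0$ on which, for a choice of the integration constant, they define a $C^1$ function $\mathcal K$ with $-1<\mathcal K<1$. "Uniquely determined by $\mathcal K(x)$ up to translations along the $z$-axis" means that two such rotational surfaces whose generatrix curves have the same momentum function $\mathcal K(x)$ on the same interval differ by a translation along the $z$-axis. The principal curvatures of $S_\alpha$ are $k_{\mathrm m}=\kappa$ (meridians; $\kappa=\dot x\ddot z-\dot z\ddot x$ is the signed curvature of $\alpha$) and $k_{\mathrm p}=\dot z/x$ (parallels). The mean curvature is $H=\frac12(k_{\mathrm m}+k_{\mathrm p})$ and the Gauss curvature is $K_{\mathrm G}=k_{\mathrm m}k_{\mathrm p}$. *)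

theory Defs
  imports "HOL-Analysis.Analysis"
begin

definition C2_on :: "(real \<Rightarrow> real) \<Rightarrow> real set \<Rightarrow> bool" where
  "C2_on f J \<longleftrightarrow> f C1_differentiable_on J \<and> deriv f C1_differentiable_on J"

text \<open>A curve \<open>\<alpha>(s) = (x(s), z(s))\<close> in the \<open>xz\<close>-plane is given by its two coordinate functions,
  on a nonempty open interval \<open>J\<close> of parameters.\<close>

definition generatrix :: "real set \<Rightarrow> (real \<Rightarrow> real) \<Rightarrow> (real \<Rightarrow> real) \<Rightarrow> bool" where
  "generatrix J x z \<longleftrightarrow>
     open J \<and> is_interval J \<and> J \<noteq> {} \<and> C2_on x J \<and> C2_on z J \<and>
     (\<forall>s\<in>J. (deriv x s)\<^sup>2 + (deriv z s)\<^sup>2 = 1) \<and> (\<forall>s\<in>J. x s > 0)"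

text \<open>An arc along which the distance \<open>x\<close> to the axis has no critical point, oriented so that
  \<open>x\<close> increases; the geometric linear momentum can then be read as a function of \<open>x\<close>.\<close>

definition oriented_arc :: "real set \<Rightarrow> (real \<Rightarrow> real) \<Rightarrow> (real \<Rightarrow> real) \<Rightarrow> bool" where
  "oriented_arc J x z \<longleftrightarrow> generatrix J x z \<and> (\<forall>s\<in>J. deriv x s > 0)"

definition rotational_surface ::
    "real set \<Rightarrow> (real \<Rightarrow> real) \<Rightarrow> (real \<Rightarrow> real) \<Rightarrow> (real ^ 3) set" where
  "rotational_surface J x z =
     {vector [x s * cos \<theta>, x s * sin \<theta>, z s] | s \<theta>. s \<in> J}"

definition z_translates :: "(real ^ 3) set \<Rightarrow> (real ^ 3) set \<Rightarrow> bool" where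
  "z_translates S T \<longleftrightarrow> (\<exists>d. T = (\<lambda>p. p + vector [0, 0, d]) ` S)"

definition linear_momentum :: "(real \<Rightarrow> real) \<Rightarrow> real \<Rightarrow> real" where
  "linear_momentum z s = deriv z s"

definition meridian_curvature :: "(real \<Rightarrow> real) \<Rightarrow> (real \<Rightarrow> real) \<Rightarrow> real \<Rightarrow> real" where
  "meridian_curvature x z s = deriv x s * deriv (deriv z) s - deriv z s * deriv (deriv x) s"

definition parallel_curvature :: "(real \<Rightarrow> real) \<Rightarrow> (real \<Rightarrow> real) \<Rightarrow> real \<Rightarrow> real" where
  "parallel_curvature x z s = deriv z s / x s"

definition mean_curvature :: "(real \<Rightarrow> real) \<Rightarrow> (real \<Rightarrow> real) \<Rightarrow> real \<Rightarrow> real" where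
  "mean_curvature x z s = (meridian_curvature x z s + parallel_curvature x z s) / 2"

definition gauss_curvature :: "(real \<Rightarrow> real) \<Rightarrow> (real \<Rightarrow> real) \<Rightarrow> real \<Rightarrow> real" where
  "gauss_curvature x z s = meridian_curvature x z s * parallel_curvature x z s"

text \<open>The functions \<open>K\<close> of the distance \<open>x \<in> I\<close> that are admitted as momentum functions. Only the
  values of \<open>K\<close> on the open interval \<open>I\<close> matter.\<close>

definition momentum_function :: "real set \<Rightarrow> (real \<Rightarrow> real) \<Rightarrow> bool" where
  "momentum_function I K \<longleftrightarrow>
     open I \<and> is_interval I \<and> I \<noteq> {} \<and> I \<subseteq> {0<..} \<and>
     K C1_differentiable_on I \<and> (\<forall>x\<in>I. - 1 < K x \<and> K x < 1)"

definition has_momentum ::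
    "real set \<Rightarrow> (real \<Rightarrow> real) \<Rightarrow> (real \<Rightarrow> real) \<Rightarrow> real set \<Rightarrow> (real \<Rightarrow> real) \<Rightarrow> bool" where
  "has_momentum J x z I K \<longleftrightarrow> x ` J = I \<and> (\<forall>s\<in>J. linear_momentum z s = K (x s))"

text \<open>For one such \<open>F\<close>, the indefinite integral of \<open>f\<close> consists of the functions \<open>F + c\<close>.\<close>

definition antiderivative_on :: "real set \<Rightarrow> (real \<Rightarrow> real) \<Rightarrow> (real \<Rightarrow> real) \<Rightarrow> bool" where
  "antiderivative_on A f F \<longleftrightarrow> (\<forall>t\<in>A. (F has_real_derivative f t) (at t))"

text \<open>The momentum functions on \<open>I\<close> with \<open>x K(x) = 2 \<integral> x H(x) dx\<close>, respectively
  \<open>K(x)\<^sup>2 = 2 \<integral> x K\<^sub>G(x) dx\<close>, where \<open>F + c\<close> is the indefinite integral with integration constant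
  \<open>c\<close>. In the second case a \<open>C\<^sup>1\<close> solution \<open>K\<close> of either sign (or changing sign) is allowed.\<close>

definition mean_momentum :: "(real \<Rightarrow> real) \<Rightarrow> real \<Rightarrow> real set \<Rightarrow> (real \<Rightarrow> real) \<Rightarrow> bool" where
  "mean_momentum F c I K \<longleftrightarrow> momentum_function I K \<and> (\<forall>t\<in>I. t * K t = 2 * (F t + c))"

definition gauss_momentum :: "(real \<Rightarrow> real) \<Rightarrow> real \<Rightarrow> real set \<Rightarrow> (real \<Rightarrow> real) \<Rightarrow> bool" where
  "gauss_momentum F c I K \<longleftrightarrow> momentum_function I K \<and> (\<forall>t\<in>I. (K t)\<^sup>2 = 2 * (F t + c))"

end

theory Submission
  imports Defs
begin

text \<open>
  On an oriented arc the momentum \<open>\<K> = z'\<close> is a \<open>C\<^sup>1\<close> function \<open>K\<close> of the distance \<open>x\<close>, because \<open>x\<close> is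
  strictly increasing. Differentiating the unit speed condition \<open>x'\<^sup>2 + z'\<^sup>2 = 1\<close> gives
  \<open>k\<^sub>m x' = z'' = K'(x) x'\<close>, so the principal curvatures are \<open>K'(x)\<close> and \<open>K(x) / x\<close>
  (\<open>meridian_curvature_eq_deriv_momentum\<close>). Hence
    \<^item> \<open>2 x H(x) = x K'(x) + K(x) = (x K(x))'\<close>,
    \<^item> \<open>2 x K\<^sub>G(x) = 2 K(x) K'(x) = (K(x)\<^sup>2)'\<close>.

  Prescribing either curvature is therefore a first order equation that says what the
  derivative of \<open>x K\<close>, respectively \<open>K\<^sup>2\<close>, is; its solutions on an interval are the
  antiderivatives, and the integration constant is the parameter of the family
  (\<open>mean_curvature_iff_mean_momentum\<close>, \<open>gauss_curvature_iff_gauss_momentum\<close>).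

  Conversely, \<open>K\<close> determines the arc by two quadratures. From \<open>x' = \<surd>(1 - K(x)\<^sup>2)\<close> the arc length
  is an antiderivative of \<open>1 / \<surd>(1 - K\<^sup>2)\<close>, whose inverse function is \<open>x\<close>
  (\<open>oriented_arc_with_momentum_exists\<close>). The height, as a function of \<open>x\<close>, is an antiderivative of
  \<open>K / \<surd>(1 - K\<^sup>2)\<close>, so two arcs with the same \<open>K\<close> differ by a constant in \<open>z\<close>
  (\<open>same_momentum_z_translates\<close>).
\<close>

section \<open>Antiderivatives and inverse functions on open intervals\<close>

lemma antiderivative_on_subset:
  "antiderivative_on A f F \<Longrightarrow> B \<subseteq> A \<Longrightarrow> antiderivative_on B f F"
  unfolding antiderivative_on_def by blast

lemma continuous_has_antiderivative:
  fixes I :: "real set"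
  assumes "open I" and "is_interval I" and f: "continuous_on I f"
  obtains F where "antiderivative_on I f F"
proof (cases "I = {}")
  case True
  then have "antiderivative_on I f f"
    by (simp add: antiderivative_on_def)
  then show ?thesis by (rule that)
next
  case False
  \<comment> \<open>The endpoints of \<open>I\<close>, possibly infinite.\<close>
  define a where "a = (INF t\<in>I. ereal t)"
  define b where "b = (SUP t\<in>I. ereal t)"
  have ends: "a < ereal t \<and> ereal t < b" if "t \<in> I" for t
  proof -
    from \<open>open I\<close> that obtain e where e: "e > 0" "ball t e \<subseteq> I"
      by (auto simp: open_contains_ball)
    have "t - e/2 \<in> I" "t + e/2 \<in> I"
      using e by (auto simp: subset_iff dist_real_def)
    then have "a \<le> ereal (t - e/2)" "ereal (t + e/2) \<le> b"
      by (auto simp: a_def b_def intro: INF_lower SUP_upper)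
    moreover have "ereal (t - e/2) < ereal t" "ereal t < ereal (t + e/2)"
      using e by auto
    ultimately show ?thesis
      using le_less_trans less_le_trans by blast
  qed
  have mem: "t \<in> I" if "a < ereal t" "ereal t < b" for t
  proof -
    from that obtain u v where "u \<in> I" "u < t" "v \<in> I" "t < v"
      unfolding a_def b_def INF_less_iff less_SUP_iff by auto
    then show ?thesis
      using \<open>is_interval I\<close> unfolding is_interval_1 by (meson less_imp_le)
  qed
  have "a < b"
    using False ends less_trans by blast
  moreover have "isCont f t" if "a < ereal t" "ereal t < b" for t
    using f mem[OF that] \<open>open I\<close> continuous_on_eq_continuous_at by blast
  ultimately obtain F where
    "\<And>t. a < ereal t \<Longrightarrow> ereal t < b \<Longrightarrow> (F has_vector_derivative f t) (at t)"
    using einterval_antiderivative[of a b f] by blast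
  then have "antiderivative_on I f F"
    using ends by (simp add: antiderivative_on_def has_real_derivative_iff_has_vector_derivative)
  then show ?thesis by (rule that)
qed

lemma DERIV_at_imp_continuous_on:
  assumes "\<And>t. t \<in> S \<Longrightarrow> (f has_field_derivative f' t) (at t)"
  shows "continuous_on S f"
  by (rule DERIV_continuous_on[where D = f']) (rule has_field_derivative_at_within, rule assms)

text \<open>Two primitives of the same function on an interval differ by a constant. The factor 2 is the
  one in the two momentum formulas.\<close>

lemma eq_twice_antiderivative_iff:
  fixes g g' f F :: "real \<Rightarrow> real"
  assumes "open I" and "is_interval I"
    and g: "\<And>t. t \<in> I \<Longrightarrow> (g has_real_derivative g' t) (at t)"
    and F: "antiderivative_on I f F"
  shows "(\<exists>c. \<forall>t\<in>I. g t = 2 * (F t + c)) \<longleftrightarrow> (\<forall>t\<in>I. g' t = 2 * f t)"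
proof
  assume "\<exists>c. \<forall>t\<in>I. g t = 2 * (F t + c)"
  then obtain c where c: "\<And>t. t \<in> I \<Longrightarrow> g t = 2 * (F t + c)"
    by blast
  show "\<forall>t\<in>I. g' t = 2 * f t"
  proof
    fix t assume t: "t \<in> I"
    have "((\<lambda>t. 2 * (F t + c)) has_real_derivative 2 * f t) (at t)"
      using F t unfolding antiderivative_on_def by (auto intro!: derivative_eq_intros)
    then have "(g has_real_derivative 2 * f t) (at t)"
      by (rule has_field_derivative_transform_within_open[OF _ \<open>open I\<close> t]) (simp add: c)
    then show "g' t = 2 * f t"
      using g[OF t] DERIV_unique by blast
  qed
next
  assume g': "\<forall>t\<in>I. g' t = 2 * f t"
  have "((\<lambda>t. g t / 2 - F t) has_real_derivative 0) (at t within I)" if "t \<in> I" for t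
  proof -
    have "((\<lambda>t. g t / 2 - F t) has_real_derivative g' t / 2 - f t) (at t)"
      using g[OF that] F that unfolding antiderivative_on_def
      by (auto intro!: derivative_eq_intros)
    then show ?thesis
      using g' that by (simp add: has_field_derivative_at_within)
  qed
  then obtain c where "\<And>t. t \<in> I \<Longrightarrow> g t / 2 - F t = c"
    using has_field_derivative_zero_constant[of I "\<lambda>t. g t / 2 - F t"] \<open>is_interval I\<close>
    by (auto simp: is_interval_convex_1)
  then have "\<forall>t\<in>I. g t = 2 * (F t + c)"
    by (force simp: field_simps)
  then show "\<exists>c. \<forall>t\<in>I. g t = 2 * (F t + c)" ..
qed

lemma positive_derivative_inverse:
  fixes f f' :: "real \<Rightarrow> real"
  assumes "open S" and "is_interval S"
    and f: "\<And>t. t \<in> S \<Longrightarrow> (f has_real_derivative f' t) (at t)"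
    and pos: "\<And>t. t \<in> S \<Longrightarrow> f' t > 0"
  obtains g where "open (f ` S)" "is_interval (f ` S)" "\<And>t. t \<in> S \<Longrightarrow> g (f t) = t"
    "\<And>t. t \<in> S \<Longrightarrow> (g has_real_derivative inverse (f' t)) (at (f t))"
proof -
  have cont: "continuous_on S f"
    by (rule DERIV_at_imp_continuous_on[OF f])
  have less: "f s < f t" if "s \<in> S" "t \<in> S" "s < t" for s t
  proof (rule DERIV_pos_imp_increasing[OF \<open>s < t\<close>])
    fix u assume "s \<le> u" "u \<le> t"
    then have "u \<in> S"
      using that \<open>is_interval S\<close> unfolding is_interval_1 by blast
    then show "\<exists>y. (f has_real_derivative y) (at u) \<and> 0 < y"
      using f pos by blast
  qed
  have inj: "inj_on f S"
    by (intro linorder_inj_onI') (use less in force)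
  let ?g = "the_inv_into S f"
  have g: "?g (f t) = t" if "t \<in> S" for t
    using inj that by (simp add: the_inv_into_f_f)
  show ?thesis
  proof
    show "open (f ` S)"
      using invariance_of_domain[OF cont \<open>open S\<close> inj] .
    show "is_interval (f ` S)"
      using cont \<open>is_interval S\<close> connected_continuous_image is_interval_connected_1 by blast
    show "?g (f t) = t" if "t \<in> S" for t
      using g that .
    show "(?g has_real_derivative inverse (f' t)) (at (f t))" if "t \<in> S" for t
    proof -
      have "(*) (f' t) \<circ> (*) (inverse (f' t)) = id"
        using pos[OF that] by (simp add: fun_eq_iff)
      then show ?thesis
        using has_derivative_inverse_strong[OF \<open>open S\<close> that cont g] f[OF that]
        unfolding has_field_derivative_def by blast
    qed
  qed
qed

section \<open>Functions of class \<open>C\<^sup>1\<close> and \<open>C\<^sup>2\<close>\<close>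

lemma C1_differentiable_onI:
  assumes "\<And>t. t \<in> S \<Longrightarrow> (f has_real_derivative f' t) (at t)" and "continuous_on S f'"
  shows "f C1_differentiable_on S"
  using assms unfolding C1_differentiable_on_def has_real_derivative_iff_has_vector_derivative
  by (intro exI[of _ f']) simp

lemma C1_differentiable_onD:
  fixes f :: "real \<Rightarrow> real"
  assumes "f C1_differentiable_on S"
  shows "t \<in> S \<Longrightarrow> (f has_real_derivative deriv f t) (at t)" and "continuous_on S (deriv f)"
proof -
  obtain D where D: "\<And>t. t \<in> S \<Longrightarrow> (f has_real_derivative D t) (at t)" "continuous_on S D"
    using assms unfolding C1_differentiable_on_def has_real_derivative_iff_has_vector_derivative
    by blast
  have eq: "deriv f t = D t" if "t \<in> S" for t
    using D(1)[OF that] by (rule DERIV_imp_deriv)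
  show "t \<in> S \<Longrightarrow> (f has_real_derivative deriv f t) (at t)"
    using D(1) eq by simp
  show "continuous_on S (deriv f)"
    using D(2) eq by (simp cong: continuous_on_cong)
qed

lemma C2_onI:
  assumes "open S"
    and f: "\<And>t. t \<in> S \<Longrightarrow> (f has_real_derivative f1 t) (at t)"
    and f1: "\<And>t. t \<in> S \<Longrightarrow> (f1 has_real_derivative f2 t) (at t)"
    and f2: "continuous_on S f2"
  shows "C2_on f S"
proof -
  have eq: "deriv f t = f1 t" if "t \<in> S" for t
    using f[OF that] by (rule DERIV_imp_deriv)
  have "continuous_on S f1"
    by (rule DERIV_at_imp_continuous_on[OF f1])
  moreover have "(deriv f has_real_derivative f2 t) (at t)" if "t \<in> S" for t
    using has_field_derivative_transform_within_open[OF f1[OF that] \<open>open S\<close> that] eq by simp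
  ultimately show ?thesis
    unfolding C2_on_def using f f2 C1_differentiable_onI by blast
qed

lemma C2_onD:
  assumes "C2_on f S"
  shows "t \<in> S \<Longrightarrow> (f has_real_derivative deriv f t) (at t)"
    and "t \<in> S \<Longrightarrow> (deriv f has_real_derivative deriv (deriv f) t) (at t)"
    and "continuous_on S (deriv (deriv f))"
  using assms C1_differentiable_onD unfolding C2_on_def by blast+

section \<open>The momentum of an oriented arc\<close>

lemma momentum_functionD:
  assumes "momentum_function I K"
  shows "open I" "is_interval I" "I \<noteq> {}" "t \<in> I \<Longrightarrow> t > 0"
    "t \<in> I \<Longrightarrow> (K has_real_derivative deriv K t) (at t)" "continuous_on I (deriv K)"
    "t \<in> I \<Longrightarrow> 1 - (K t)\<^sup>2 > 0"
proof -
  show "open I" "is_interval I" "I \<noteq> {}" "t \<in> I \<Longrightarrow> t > 0"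
    "t \<in> I \<Longrightarrow> (K has_real_derivative deriv K t) (at t)" "continuous_on I (deriv K)"
    using assms C1_differentiable_onD unfolding momentum_function_def by auto
  show "t \<in> I \<Longrightarrow> 1 - (K t)\<^sup>2 > 0"
    using assms abs_square_less_1[of "K t"] unfolding momentum_function_def by auto
qed

lemma oriented_arcD:
  assumes "oriented_arc J x z"
  shows "open J" "is_interval J" "J \<noteq> {}" "C2_on x J" "C2_on z J"
    "s \<in> J \<Longrightarrow> (deriv x s)\<^sup>2 + (deriv z s)\<^sup>2 = 1" "s \<in> J \<Longrightarrow> x s > 0" "s \<in> J \<Longrightarrow> deriv x s > 0"
  using assms unfolding oriented_arc_def generatrix_def by auto

lemma oriented_arc_deriv_x:
  assumes "oriented_arc J x z" and "s \<in> J"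
  shows "deriv x s = sqrt (1 - (deriv z s)\<^sup>2)"
  using oriented_arcD(6,8)[OF assms] by (intro real_sqrt_unique[symmetric]) auto

text \<open>Since \<open>x' > 0\<close>, the parameter is a \<open>C\<^sup>1\<close> function \<open>g\<close> of the distance, and the momentum
  function is \<open>z' \<circ> g\<close>.\<close>

lemma oriented_arc_has_momentum:
  assumes arc: "oriented_arc J x z"
  obtains K where "momentum_function (x ` J) K" "has_momentum J x z (x ` J) K"
proof -
  note D = oriented_arcD[OF arc]
  obtain g where g: "open (x ` J)" "is_interval (x ` J)" "\<And>s. s \<in> J \<Longrightarrow> g (x s) = s"
    "\<And>s. s \<in> J \<Longrightarrow> (g has_real_derivative inverse (deriv x s)) (at (x s))"
    using positive_derivative_inverse[OF D(1,2) C2_onD(1)[OF D(4)] D(8)] by blast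
  let ?K = "\<lambda>t. deriv z (g t)"
  let ?K' = "\<lambda>t. deriv (deriv z) (g t) * inverse (deriv x (g t))"
  have K': "(?K has_real_derivative ?K' t) (at t)" if "t \<in> x ` J" for t
  proof -
    from that obtain s where s: "s \<in> J" "t = x s"
      by blast
    have "(deriv z has_real_derivative deriv (deriv z) (g t)) (at (g t))"
      using C2_onD(2)[OF D(5) s(1)] by (simp add: s g(3))
    moreover have "(g has_real_derivative inverse (deriv x (g t))) (at t)"
      using g(4)[OF s(1)] by (simp add: s g(3))
    ultimately show ?thesis
      by (rule DERIV_chain2)
  qed
  have "continuous_on (x ` J) g"
    using g(4) by (intro DERIV_at_imp_continuous_on[of _ _ "\<lambda>t. inverse (deriv x (g t))"])
      (auto simp: g(3))
  moreover have "g ` x ` J \<subseteq> J"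
    using g(3) by auto
  ultimately have comp: "continuous_on (x ` J) (\<lambda>t. f (g t))"
    if "continuous_on J f" for f :: "real \<Rightarrow> real"
    using continuous_on_compose2[OF that] by blast
  have "continuous_on J (deriv x)"
    by (rule DERIV_at_imp_continuous_on[OF C2_onD(2)[OF D(4)]])
  moreover have "\<forall>t\<in>x ` J. deriv x (g t) \<noteq> 0"
    using D(8) g(3) by fastforce
  ultimately have "continuous_on (x ` J) ?K'"
    using C2_onD(3)[OF D(5)] by (intro continuous_on_mult continuous_on_inverse comp)
  then have "?K C1_differentiable_on x ` J"
    using K' by (rule C1_differentiable_onI[rotated])
  moreover have "- 1 < deriv z s \<and> deriv z s < 1" if "s \<in> J" for s
  proof -
    have "(deriv z s)\<^sup>2 < 1"
      using D(6)[OF that] D(8)[OF that] by (smt (verit) zero_less_power)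
    then show ?thesis
      by (simp add: abs_square_less_1 abs_less_iff)
  qed
  ultimately have "momentum_function (x ` J) ?K"
    using g(1,2,3) D(3,7) unfolding momentum_function_def by auto
  moreover have "has_momentum J x z (x ` J) ?K"
    using g(3) by (simp add: has_momentum_def linear_momentum_def)
  ultimately show ?thesis
    by (rule that)
qed

text \<open>Unit speed turns the curvature into \<open>z'' / x'\<close>: since \<open>x' x'' = - z' z''\<close>,
  \<open>x' k\<^sub>m = x'\<^sup>2 z'' - z' (x' x'') = (x'\<^sup>2 + z'\<^sup>2) z'' = z''\<close>. By the chain rule
  \<open>z'' = K'(x) x'\<close>.\<close>

lemma meridian_curvature_eq_deriv_momentum:
  assumes arc: "oriented_arc J x z" and mom: "has_momentum J x z I K"
    and K: "momentum_function I K" and s: "s \<in> J"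
  shows "meridian_curvature x z s = deriv K (x s)"
proof -
  note D = oriented_arcD[OF arc]
  let ?x1 = "deriv x s" and ?z1 = "deriv z s"
  let ?x2 = "deriv (deriv x) s" and ?z2 = "deriv (deriv z) s"
  have xI: "x s \<in> I" and eq: "\<And>s. s \<in> J \<Longrightarrow> deriv z s = K (x s)"
    using mom s by (auto simp: has_momentum_def linear_momentum_def)
  have "((\<lambda>s. K (x s)) has_real_derivative deriv K (x s) * ?x1) (at s)"
    using momentum_functionD(5)[OF K xI] C2_onD(1)[OF D(4) s] by (rule DERIV_chain2)
  then have "(deriv z has_real_derivative deriv K (x s) * ?x1) (at s)"
    by (rule has_field_derivative_transform_within_open[OF _ D(1) s]) (simp add: eq)
  then have z2: "?z2 = deriv K (x s) * ?x1"
    by (rule DERIV_imp_deriv)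
  have "((\<lambda>s. (deriv x s)\<^sup>2 + (deriv z s)\<^sup>2) has_real_derivative 2 * ?x1 * ?x2 + 2 * ?z1 * ?z2)
      (at s)"
    using C2_onD(2)[OF D(4) s] C2_onD(2)[OF D(5) s]
    by (auto intro!: derivative_eq_intros)
  then have "((\<lambda>s. 1) has_real_derivative 2 * ?x1 * ?x2 + 2 * ?z1 * ?z2) (at s)"
    by (rule has_field_derivative_transform_within_open[OF _ D(1) s]) (simp add: D(6))
  then have orth: "?x1 * ?x2 = - (?z1 * ?z2)"
    using DERIV_unique[OF DERIV_const[of 1 "at s"]] by force
  have "?x1 * meridian_curvature x z s = ?x1\<^sup>2 * ?z2 - ?z1 * (?x1 * ?x2)"
    by (simp add: meridian_curvature_def algebra_simps power2_eq_square)
  also have "\<dots> = (?x1\<^sup>2 + ?z1\<^sup>2) * ?z2"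
    by (simp add: orth algebra_simps power2_eq_square)
  also have "\<dots> = ?x1 * deriv K (x s)"
    by (simp add: D(6)[OF s] z2)
  finally show ?thesis
    using D(8)[OF s] by simp
qed

section \<open>Existence and uniqueness of the arc with a given momentum\<close>

text \<open>The equation \<open>x' = q(x)\<close> with \<open>q = \<surd>(1 - K\<^sup>2)\<close> is separable: its solution is the inverse of a
  primitive \<open>G\<close> of \<open>1 / q\<close>, so that the solution runs through the whole of \<open>I\<close>.\<close>

lemma oriented_arc_with_momentum_exists:
  assumes K: "momentum_function I K"
  obtains J x z where "oriented_arc J x z" "has_momentum J x z I K"
proof -
  note D = momentum_functionD[OF K]
  define q where "q = (\<lambda>t. sqrt (1 - (K t)\<^sup>2))"
  have q: "q t > 0" "(q t)\<^sup>2 = 1 - (K t)\<^sup>2" if "t \<in> I" for t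
    using D(7)[OF that] by (auto simp: q_def)
  have q': "(q has_real_derivative - K t * deriv K t / q t) (at t)" if "t \<in> I" for t
    unfolding q_def using D(5)[OF that] D(7)[OF that]
    by (auto intro!: derivative_eq_intros simp: field_simps)
  have contK: "continuous_on I K"
    by (rule DERIV_at_imp_continuous_on[OF D(5)])
  have contq: "continuous_on I q"
    by (rule DERIV_at_imp_continuous_on[OF q'])
  have nz: "\<forall>t\<in>I. q t \<noteq> 0"
    using q(1) by force
  obtain G where G: "antiderivative_on I (\<lambda>t. 1 / q t) G"
    using continuous_has_antiderivative[OF D(1,2)
        continuous_on_divide[OF continuous_on_const contq nz]] .
  obtain W where W: "antiderivative_on I (\<lambda>t. K t / q t) W"
    using continuous_has_antiderivative[OF D(1,2) continuous_on_divide[OF contK contq nz]] .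
  have G': "(G has_real_derivative 1 / q t) (at t)" if "t \<in> I" for t
    using G that by (simp add: antiderivative_on_def)
  obtain x where x: "open (G ` I)" "is_interval (G ` I)" "\<And>t. t \<in> I \<Longrightarrow> x (G t) = t"
    "\<And>t. t \<in> I \<Longrightarrow> (x has_real_derivative inverse (1 / q t)) (at (G t))"
    using positive_derivative_inverse[OF D(1,2) G'] q(1) by auto
  let ?J = "G ` I"
  let ?z = "\<lambda>s. W (x s)"
  have xI: "x s \<in> I" if "s \<in> ?J" for s
    using that x(3) by auto
  have x': "(x has_real_derivative q (x s)) (at s)" if "s \<in> ?J" for s
    using that x(3,4) by force
  have z': "(?z has_real_derivative K (x s)) (at s)" if "s \<in> ?J" for s
  proof -
    have "(W has_real_derivative K (x s) / q (x s)) (at (x s))"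
      using W xI[OF that] by (simp add: antiderivative_on_def)
    from DERIV_chain2[OF this x'[OF that]] show ?thesis
      using q(1)[OF xI[OF that]] by simp
  qed
  have x'': "((\<lambda>s. q (x s)) has_real_derivative - K (x s) * deriv K (x s)) (at s)"
    if "s \<in> ?J" for s
    using DERIV_chain2[OF q'[OF xI[OF that]] x'[OF that]] q(1)[OF xI[OF that]] by simp
  have z'': "((\<lambda>s. K (x s)) has_real_derivative deriv K (x s) * q (x s)) (at s)"
    if "s \<in> ?J" for s
    using DERIV_chain2[OF D(5)[OF xI[OF that]] x'[OF that]] .
  have contx: "continuous_on ?J x"
    by (rule DERIV_at_imp_continuous_on[OF x'])
  have comp: "continuous_on ?J (\<lambda>s. f (x s))" if "continuous_on I f" for f :: "real \<Rightarrow> real"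
    using continuous_on_compose2[OF that contx] xI by blast
  have "C2_on x ?J"
    using comp[OF contK] comp[OF D(6)]
    by (intro C2_onI[OF x(1) x' x'']) (auto intro!: continuous_intros)
  moreover have "C2_on ?z ?J"
    using comp[OF contq] comp[OF D(6)]
    by (intro C2_onI[OF x(1) z' z'']) (auto intro!: continuous_intros)
  ultimately have "oriented_arc ?J x ?z"
    using x(1,2) D(3,4) q xI DERIV_imp_deriv[OF x'] DERIV_imp_deriv[OF z']
    by (simp add: oriented_arc_def generatrix_def)
  moreover have "has_momentum ?J x ?z I K"
    using x(3) DERIV_imp_deriv[OF z'] by (force simp: has_momentum_def linear_momentum_def)
  ultimately show ?thesis
    by (rule that)
qed

text \<open>Along the arc \<open>dz/dx = z' / x' = K / \<surd>(1 - K\<^sup>2)\<close>.\<close>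

lemma height_eq_antiderivative:
  assumes arc: "oriented_arc J x z" and mom: "has_momentum J x z I K"
    and W: "antiderivative_on I (\<lambda>t. K t / sqrt (1 - (K t)\<^sup>2)) W"
  obtains d where "\<And>s. s \<in> J \<Longrightarrow> z s = W (x s) + d"
proof -
  note D = oriented_arcD[OF arc]
  have "((\<lambda>s. z s - W (x s)) has_real_derivative 0) (at s within J)" if s: "s \<in> J" for s
  proof -
    have xI: "x s \<in> I" and eq: "deriv z s = K (x s)"
      using mom s by (auto simp: has_momentum_def linear_momentum_def)
    have x': "deriv x s = sqrt (1 - (K (x s))\<^sup>2)"
      using oriented_arc_deriv_x[OF arc s] by (simp add: eq)
    have "(W has_real_derivative K (x s) / deriv x s) (at (x s))"
      using W xI by (simp add: antiderivative_on_def x')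
    from DERIV_chain2[OF this C2_onD(1)[OF D(4) s]]
    have "((\<lambda>s. W (x s)) has_real_derivative deriv z s) (at s)"
      using D(8)[OF s] by (simp add: eq)
    from DERIV_diff[OF C2_onD(1)[OF D(5) s] this] show ?thesis
      by (simp add: has_field_derivative_at_within)
  qed
  then obtain d where "\<And>s. s \<in> J \<Longrightarrow> z s - W (x s) = d"
    using has_field_derivative_zero_constant[of J "\<lambda>s. z s - W (x s)"] D(2)
    by (auto simp: is_interval_convex_1)
  then show ?thesis
    by (intro that[of d]) (auto simp: algebra_simps)
qed

text \<open>Both surfaces are the surface of revolution of a graph \<open>z = W(x) + const\<close> over the same
  interval \<open>I\<close>; the parametrizations of the arcs have disappeared from this description.\<close>

lemma same_momentum_z_translates:
  assumes K: "momentum_function I K"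
    and arc: "oriented_arc J x z" "has_momentum J x z I K"
    and arc': "oriented_arc J' x' z'" "has_momentum J' x' z' I K"
  shows "z_translates (rotational_surface J x z) (rotational_surface J' x' z')"
proof -
  note D = momentum_functionD[OF K]
  have "continuous_on I K"
    by (rule DERIV_at_imp_continuous_on[OF D(5)])
  then have "continuous_on I (\<lambda>t. K t / sqrt (1 - (K t)\<^sup>2))"
    using D(7) by (intro continuous_intros) force+
  then obtain W where W: "antiderivative_on I (\<lambda>t. K t / sqrt (1 - (K t)\<^sup>2)) W"
    using continuous_has_antiderivative[OF D(1,2)] by blast
  define S where
    "S d = {vector [t * cos \<theta>, t * sin \<theta>, W t + d] :: real ^ 3 | t \<theta>. t \<in> I}" for d
  have surface: "\<exists>d. rotational_surface J x z = S d"
    if arc: "oriented_arc J x z" and mom: "has_momentum J x z I K" for J x z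
  proof -
    obtain d where "\<And>s. s \<in> J \<Longrightarrow> z s = W (x s) + d"
      using height_eq_antiderivative[OF arc mom W] by blast
    then have "rotational_surface J x z =
        {vector [x s * cos \<theta>, x s * sin \<theta>, W (x s) + d] | s \<theta>. s \<in> J}"
      unfolding rotational_surface_def by (intro Collect_cong) (metis (no_types, lifting))
    moreover have "x ` J = I"
      using mom by (simp add: has_momentum_def)
    ultimately have "rotational_surface J x z = S d"
      unfolding S_def by blast
    then show ?thesis ..
  qed
  obtain d d' where eq: "rotational_surface J x z = S d" "rotational_surface J' x' z' = S d'"
    using surface[OF arc] surface[OF arc'] by blast
  have "(vector [a, b, c + d'] :: real ^ 3) = vector [a, b, c + d] + vector [0, 0, d' - d]"
    for a b c
    by (simp add: vec_eq_iff forall_3)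
  then have "S d' = (\<lambda>p. p + vector [0, 0, d' - d]) ` S d"
    unfolding S_def by (auto simp: image_def)
  then show ?thesis
    unfolding z_translates_def eq by blast
qed

section \<open>Curvature prescribed as a function of the distance\<close>

text \<open>What the mean and the Gauss curvature have in common: \<open>M c\<close> are the solutions with
  integration constant \<open>c\<close> of a condition on the momentum function that is equivalent to
  curvature \<open>f(x)\<close> along every arc with that momentum function.\<close>

lemma surfaces_of_prescribed_curvature:
  fixes curv :: "(real \<Rightarrow> real) \<Rightarrow> (real \<Rightarrow> real) \<Rightarrow> real \<Rightarrow> real"
    and M :: "real \<Rightarrow> real set \<Rightarrow> (real \<Rightarrow> real) \<Rightarrow> bool"
  assumes M: "\<And>c I K. M c I K \<Longrightarrow> momentum_function I K"
    and char: "\<And>J x z I K. oriented_arc J x z \<Longrightarrow> has_momentum J x z I K \<Longrightarrow>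
      momentum_function I K \<Longrightarrow> (\<forall>s\<in>J. curv x z s = f (x s)) \<longleftrightarrow> (\<exists>c. M c I K)"
  shows
    "(\<forall>c I K. M c I K \<longrightarrow>
        (\<exists>J x z. oriented_arc J x z \<and> has_momentum J x z I K \<and> (\<forall>s\<in>J. curv x z s = f (x s))) \<and>
        (\<forall>J x z J' x' z'.
            oriented_arc J x z \<and> has_momentum J x z I K \<and>
            oriented_arc J' x' z' \<and> has_momentum J' x' z' I K \<longrightarrow>
            z_translates (rotational_surface J x z) (rotational_surface J' x' z'))) \<and>
     (\<forall>J x z. oriented_arc J x z \<longrightarrow>
        (\<forall>s\<in>J. curv x z s = f (x s)) \<longleftrightarrow>
        (\<exists>c K. M c (x ` J) K \<and> has_momentum J x z (x ` J) K))"
proof (intro conjI allI impI)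
  fix c I K assume MK: "M c I K"
  obtain J x z where arc: "oriented_arc J x z" "has_momentum J x z I K"
    using oriented_arc_with_momentum_exists[OF M[OF MK]] .
  have "\<forall>s\<in>J. curv x z s = f (x s)"
    using char[OF arc M[OF MK]] MK by blast
  with arc show "\<exists>J x z. oriented_arc J x z \<and> has_momentum J x z I K \<and>
      (\<forall>s\<in>J. curv x z s = f (x s))"
    by blast
next
  fix c I K J x z J' x' z'
  assume "M c I K" and "oriented_arc J x z \<and> has_momentum J x z I K \<and>
    oriented_arc J' x' z' \<and> has_momentum J' x' z' I K"
  then show "z_translates (rotational_surface J x z) (rotational_surface J' x' z')"
    using same_momentum_z_translates M by blast
next
  fix J x z assume arc: "oriented_arc J x z"
  obtain K where K: "momentum_function (x ` J) K" "has_momentum J x z (x ` J) K"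
    using oriented_arc_has_momentum[OF arc] .
  show "(\<forall>s\<in>J. curv x z s = f (x s)) \<longleftrightarrow>
      (\<exists>c K. M c (x ` J) K \<and> has_momentum J x z (x ` J) K)"
    using char[OF arc] K M by blast
qed

lemma mean_curvature_iff_mean_momentum:
  assumes F: "antiderivative_on {0<..} (\<lambda>t. t * H t) F"
    and arc: "oriented_arc J x z" and mom: "has_momentum J x z I K"
    and K: "momentum_function I K"
  shows "(\<forall>s\<in>J. mean_curvature x z s = H (x s)) \<longleftrightarrow> (\<exists>c. mean_momentum F c I K)"
proof -
  note D = momentum_functionD[OF K]
  have I: "x ` J = I"
    using mom by (simp add: has_momentum_def)
  have "mean_curvature x z s = (deriv K (x s) + K (x s) / x s) / 2" if "s \<in> J" for s
    using meridian_curvature_eq_deriv_momentum[OF arc mom K that] mom that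
    by (simp add: mean_curvature_def parallel_curvature_def has_momentum_def linear_momentum_def)
  then have "(\<forall>s\<in>J. mean_curvature x z s = H (x s)) \<longleftrightarrow>
      (\<forall>t\<in>I. (deriv K t + K t / t) / 2 = H t)"
    unfolding I[symmetric] by (simp del: eq_divide_eq_numeral1 divide_eq_eq_numeral1)
  also have "\<dots> \<longleftrightarrow> (\<forall>t\<in>I. t * deriv K t + K t = 2 * (t * H t))"
    using D(4) by (intro ball_cong refl) (force simp: field_simps)
  also have "\<dots> \<longleftrightarrow> (\<exists>c. \<forall>t\<in>I. t * K t = 2 * (F t + c))"
  proof (rule eq_twice_antiderivative_iff[OF D(1,2), symmetric])
    show "((\<lambda>t. t * K t) has_real_derivative t * deriv K t + K t) (at t)" if "t \<in> I" for t
      using D(5)[OF that] by (auto intro!: derivative_eq_intros)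
    show "antiderivative_on I (\<lambda>t. t * H t) F"
      using F D(4) by (auto intro: antiderivative_on_subset)
  qed
  also have "\<dots> \<longleftrightarrow> (\<exists>c. mean_momentum F c I K)"
    using K by (simp add: mean_momentum_def)
  finally show ?thesis .
qed

lemma gauss_curvature_iff_gauss_momentum:
  assumes F: "antiderivative_on {0<..} (\<lambda>t. t * k t) F"
    and arc: "oriented_arc J x z" and mom: "has_momentum J x z I K"
    and K: "momentum_function I K"
  shows "(\<forall>s\<in>J. gauss_curvature x z s = k (x s)) \<longleftrightarrow> (\<exists>c. gauss_momentum F c I K)"
proof -
  note D = momentum_functionD[OF K]
  have I: "x ` J = I"
    using mom by (simp add: has_momentum_def)
  have "gauss_curvature x z s = deriv K (x s) * (K (x s) / x s)" if "s \<in> J" for s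
    using meridian_curvature_eq_deriv_momentum[OF arc mom K that] mom that
    by (simp add: gauss_curvature_def parallel_curvature_def has_momentum_def linear_momentum_def)
  then have "(\<forall>s\<in>J. gauss_curvature x z s = k (x s)) \<longleftrightarrow>
      (\<forall>t\<in>I. deriv K t * (K t / t) = k t)"
    unfolding I[symmetric] by simp
  also have "\<dots> \<longleftrightarrow> (\<forall>t\<in>I. 2 * K t * deriv K t = 2 * (t * k t))"
    using D(4) by (intro ball_cong refl) (force simp: field_simps)
  also have "\<dots> \<longleftrightarrow> (\<exists>c. \<forall>t\<in>I. (K t)\<^sup>2 = 2 * (F t + c))"
  proof (rule eq_twice_antiderivative_iff[OF D(1,2), symmetric])
    show "((\<lambda>t. (K t)\<^sup>2) has_real_derivative 2 * K t * deriv K t) (at t)" if "t \<in> I" for t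
      using D(5)[OF that] by (auto intro!: derivative_eq_intros)
    show "antiderivative_on I (\<lambda>t. t * k t) F"
      using F D(4) by (auto intro: antiderivative_on_subset)
  qed
  also have "\<dots> \<longleftrightarrow> (\<exists>c. gauss_momentum F c I K)"
    using K by (simp add: gauss_momentum_def)
  finally show ?thesis .
qed

section \<open>The one-parameter families\<close>

lemma momentum_function_near:
  assumes "open U" "t \<in> U" "U \<subseteq> {0<..}" and K: "K C1_differentiable_on U" "\<bar>K t\<bar> < 1"
  obtains I where "t \<in> I" "I \<subseteq> U" "momentum_function I K"
proof -
  have "continuous_on U K"
    using K(1) by (rule C1_differentiable_imp_continuous_on)
  then have "open (U \<inter> K -` {-1<..<1})"
    using \<open>open U\<close> by (simp add: continuous_open_preimage)
  then obtain e where e: "e > 0" "ball t e \<subseteq> U \<inter> K -` {-1<..<1}"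
    using assms(2) K(2) by (force simp: open_contains_ball)
  have "K C1_differentiable_on ball t e"
    using K(1) e(2) C1_differentiable_on_subset by blast
  then have "momentum_function (ball t e) K"
    using e assms(3) unfolding momentum_function_def by (auto simp: is_interval_convex_1)
  then show ?thesis
    using e by (intro that[of "ball t e"]) auto
qed

lemma mean_momentum_family:
  assumes H: "continuous_on {0<..} H" and F: "antiderivative_on {0<..} (\<lambda>t. t * H t) F"
    and "t > 0"
  shows "\<exists>c\<^sub>1 c\<^sub>2. c\<^sub>1 < c\<^sub>2 \<and> (\<forall>c\<in>{c\<^sub>1<..<c\<^sub>2}. \<exists>I K. t \<in> I \<and> mean_momentum F c I K)"
proof -
  have F': "(F has_real_derivative u * H u) (at u)" if "u > 0" for u
    using F that by (simp add: antiderivative_on_def)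
  have contF: "continuous_on {0<..} F"
    by (rule DERIV_at_imp_continuous_on[of _ _ "\<lambda>u. u * H u"]) (simp add: F')
  have "\<exists>I K. t \<in> I \<and> mean_momentum F c I K" if c: "c \<in> {- t/2 - F t<..<t/2 - F t}" for c
  proof -
    let ?K = "\<lambda>u. 2 * (F u + c) / u"
    have "?K C1_differentiable_on {0<..}"
    proof (rule C1_differentiable_onI)
      show "(?K has_real_derivative (2 * (u * H u) * u - 2 * (F u + c)) / (u * u)) (at u)"
        if "u \<in> {0<..}" for u
        using F'[of u] that by (auto intro!: derivative_eq_intros)
      show "continuous_on {0<..} (\<lambda>u. (2 * (u * H u) * u - 2 * (F u + c)) / (u * u))"
        using H contF by (auto intro!: continuous_intros)
    qed
    moreover have "\<bar>?K t\<bar> < 1"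
      using c \<open>t > 0\<close> by (auto simp: abs_less_iff field_simps)
    ultimately obtain I where I: "t \<in> I" "I \<subseteq> {0<..}" "momentum_function I ?K"
      using momentum_function_near[of "{0<..}" t ?K] \<open>t > 0\<close> by auto
    then have "mean_momentum F c I ?K"
      by (auto simp: mean_momentum_def)
    with I(1) show ?thesis by blast
  qed
  moreover have "- t/2 - F t < t/2 - F t"
    using \<open>t > 0\<close> by simp
  ultimately show ?thesis by blast
qed

text \<open>For the Gauss curvature \<open>c\<close> is taken so that \<open>0 < 2 (F(t) + c) < 1\<close>: the square root of
  \<open>2 (F + c)\<close> is then differentiable near \<open>t\<close>.\<close>

lemma gauss_momentum_family:
  assumes k: "continuous_on {0<..} k" and F: "antiderivative_on {0<..} (\<lambda>t. t * k t) F"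
    and "t > 0"
  shows "\<exists>c\<^sub>1 c\<^sub>2. c\<^sub>1 < c\<^sub>2 \<and> (\<forall>c\<in>{c\<^sub>1<..<c\<^sub>2}. \<exists>I K. t \<in> I \<and> gauss_momentum F c I K)"
proof -
  have F': "(F has_real_derivative u * k u) (at u)" if "u > 0" for u
    using F that by (simp add: antiderivative_on_def)
  have contF: "continuous_on {0<..} F"
    by (rule DERIV_at_imp_continuous_on[of _ _ "\<lambda>u. u * k u"]) (simp add: F')
  have "\<exists>I K. t \<in> I \<and> gauss_momentum F c I K" if c: "c \<in> {- F t<..<1/2 - F t}" for c
  proof -
    let ?K = "\<lambda>u. sqrt (2 * (F u + c))"
    let ?K' = "\<lambda>u. u * k u / sqrt (2 * (F u + c))"
    define U where "U = {0<..} \<inter> F -` {- c<..}"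
    have U: "open U" "U \<subseteq> {0<..}" "\<And>u. u \<in> U \<Longrightarrow> F u + c > 0"
      unfolding U_def using continuous_open_preimage[OF contF] by auto
    have "?K C1_differentiable_on U"
    proof (rule C1_differentiable_onI)
      show "(?K has_real_derivative ?K' u) (at u)" if "u \<in> U" for u
      proof -
        have "u > 0" "F u + c > 0"
          using U(2,3) that by auto
        then show ?thesis
          using F' by (auto intro!: derivative_eq_intros simp: field_simps)
      qed
      have "continuous_on U F" "continuous_on U k"
        using contF k U(2) continuous_on_subset by blast+
      then show "continuous_on U ?K'"
        using U(3) by (intro continuous_intros) force+
    qed
    moreover have "t \<in> U" "\<bar>?K t\<bar> < 1"
      using c \<open>t > 0\<close> by (auto simp: U_def)
    ultimately obtain I where I: "t \<in> I" "I \<subseteq> U" "momentum_function I ?K"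
      using momentum_function_near[OF U(1) _ U(2)] by blast
    then have "gauss_momentum F c I ?K"
      using U(3) by (force simp: gauss_momentum_def less_imp_le)
    with I(1) show ?thesis by blast
  qed
  moreover have "- F t < 1/2 - F t"
    by simp
  ultimately show ?thesis by blast
qed

lemma weighted_antiderivative_exists:
  fixes f :: "real \<Rightarrow> real"
  assumes "continuous_on {0<..} f"
  shows "\<exists>F. antiderivative_on {0<..} (\<lambda>t. t * f t) F"
proof -
  have "continuous_on {0<..} (\<lambda>t. t * f t)"
    using assms by (intro continuous_intros)
  then show ?thesis
    using continuous_has_antiderivative[of "{0<..}" "\<lambda>t. t * f t"]
    by (auto simp: is_interval_convex_1)
qed

theorem theorem4p1:
  fixes H K\<^sub>G :: "real \<Rightarrow> real"
  assumes "continuous_on {0<..} H" and "continuous_on {0<..} K\<^sub>G"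
  shows
    "((\<exists>F. antiderivative_on {0<..} (\<lambda>t. t * H t) F) \<and>
     (\<forall>F. antiderivative_on {0<..} (\<lambda>t. t * H t) F \<longrightarrow>
        (\<forall>t>0. \<exists>c\<^sub>1 c\<^sub>2. c\<^sub>1 < c\<^sub>2 \<and>
            (\<forall>c\<in>{c\<^sub>1<..<c\<^sub>2}. \<exists>I K. t \<in> I \<and> mean_momentum F c I K)) \<and>
        (\<forall>c I K. mean_momentum F c I K \<longrightarrow>
            (\<exists>J x z. oriented_arc J x z \<and> has_momentum J x z I K \<and>
                (\<forall>s\<in>J. mean_curvature x z s = H (x s))) \<and>
            (\<forall>J x z J' x' z'.
                oriented_arc J x z \<and> has_momentum J x z I K \<and>
                oriented_arc J' x' z' \<and> has_momentum J' x' z' I K \<longrightarrow>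
                z_translates (rotational_surface J x z) (rotational_surface J' x' z'))) \<and>
        (\<forall>J x z. oriented_arc J x z \<longrightarrow>
            (\<forall>s\<in>J. mean_curvature x z s = H (x s)) \<longleftrightarrow>
            (\<exists>c K. mean_momentum F c (x ` J) K \<and> has_momentum J x z (x ` J) K)))) \<and>
    ((\<exists>F. antiderivative_on {0<..} (\<lambda>t. t * K\<^sub>G t) F) \<and>
     (\<forall>F. antiderivative_on {0<..} (\<lambda>t. t * K\<^sub>G t) F \<longrightarrow>
        (\<forall>t>0. \<exists>c\<^sub>1 c\<^sub>2. c\<^sub>1 < c\<^sub>2 \<and>
            (\<forall>c\<in>{c\<^sub>1<..<c\<^sub>2}. \<exists>I K. t \<in> I \<and> gauss_momentum F c I K)) \<and>
        (\<forall>c I K. gauss_momentum F c I K \<longrightarrow>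
            (\<exists>J x z. oriented_arc J x z \<and> has_momentum J x z I K \<and>
                (\<forall>s\<in>J. gauss_curvature x z s = K\<^sub>G (x s))) \<and>
            (\<forall>J x z J' x' z'.
                oriented_arc J x z \<and> has_momentum J x z I K \<and>
                oriented_arc J' x' z' \<and> has_momentum J' x' z' I K \<longrightarrow>
                z_translates (rotational_surface J x z) (rotational_surface J' x' z'))) \<and>
        (\<forall>J x z. oriented_arc J x z \<longrightarrow>
            (\<forall>s\<in>J. gauss_curvature x z s = K\<^sub>G (x s)) \<longleftrightarrow>
            (\<exists>c K. gauss_momentum F c (x ` J) K \<and> has_momentum J x z (x ` J) K))))"
proof -
  have mean: "mean_momentum F c I K \<Longrightarrow> momentum_function I K"
    and gauss: "gauss_momentum F c I K \<Longrightarrow> momentum_function I K" for F c I K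
    by (simp_all add: mean_momentum_def gauss_momentum_def)
  note mean_part = mean_momentum_family[OF assms(1)]
    surfaces_of_prescribed_curvature[OF mean mean_curvature_iff_mean_momentum]
  note gauss_part = gauss_momentum_family[OF assms(2)]
    surfaces_of_prescribed_curvature[OF gauss gauss_curvature_iff_gauss_momentum]
  show ?thesis
    by (intro conjI[OF conjI conjI] weighted_antiderivative_exists assms;
        intro allI impI conjI[OF _ mean_part(2)] conjI[OF _ gauss_part(2)]
          mean_part(1) gauss_part(1))
qed

end
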